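(* Let $n,m,\ell$ be integers with $1\leq \ell+1\leq m\leq n$. Let $X_1,X_2,\ldots,X_n$ be independent geometric random variables, where $X_i$ has parameter $p_i\in(0,1)$ for $1\leq i\leq n$. Then the maximal correlation coefficient of the two minima is $$R\left(\min_{i:1\leq i\leq m}X_i,\ \min_{j:\ell+1\leq j\leq n}X_j\right)=\frac{\prod_{i=1}^{n}(1-p_i)-\left(\prod_{i=1}^{m}(1-p_i)\right)\left(\prod_{i=\ell+1}^{n}(1-p_i)\right)}{\sqrt{\left(\prod_{i=1}^{m}(1-p_i)\right)\left(1-\prod_{i=1}^{m}(1-p_i)\right)\left(\prod_{i=\ell+1}^{n}(1-p_i)\right)\left(1-\prod_{i=\ell+1}^{n}(1-p_i)\right)}}.$$ In particular, for $n=3$, $m=2$ and $\ell=1$, $$R(\min(X_1,X_2),\min(X_2,X_3))=\frac{\sqrt{(1-p_1)(1-p_3)}\,p_2}{\sqrt{(1-(1-p_1)(1-p_2))(1-(1-p_2)(1-p_3))}}.$$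
   Context: For two non-degenerate random variables $X$ and $Y$ on the same probability space, the maximal correlation coefficient is $$R(X,Y)=\sup\frac{\operatorname{Cov}(\varphi(X),\psi(Y))}{\sqrt{\operatorname{Var}(\varphi(X))\operatorname{Var}(\psi(Y))}},$$ where the supremum is over all (real-valued) measurable functions $\varphi$ and $\psi$ such that $\operatorname{Var}(\varphi(X)),\operatorname{Var}(\psi(Y))\in(0,\infty)$. A geometric random variable $X$ with parameter $p\in(0,1)$ takes values in $\{1,2,3,\ldots\}$ with $P(X=k)=(1-p)^{k-1}p$ for $k\geq 1$. *)

theory Defs
  imports "HOL-Probability.Probability"
begin

context prob_space
begin

definition covariance :: "('a \<Rightarrow> real) \<Rightarrow> ('a \<Rightarrow> real) \<Rightarrow> real" where
  "covariance U V = expectation (\<lambda>\<omega>. (U \<omega> - expectation U) * (V \<omega> - expectation V))"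

text \<open>The variance of \<open>U\<close> lies in \<open>(0, \<infinity>)\<close>. Since the Bochner integral of a non-integrable
  function is 0, finiteness is expressed by square-integrability.\<close>

definition pos_finite_variance :: "('a \<Rightarrow> real) \<Rightarrow> bool" where
  "pos_finite_variance U \<longleftrightarrow>
     random_variable borel U \<and> integrable M (\<lambda>\<omega>. (U \<omega>)\<^sup>2) \<and> 0 < variance U"

text \<open>For non-degenerate random variables \<open>X\<close> and \<open>Y\<close> the set below is nonempty, and by the
  Cauchy-Schwarz inequality it is bounded above by 1, so \<open>Sup\<close> on the reals is its
  supremum.\<close>

definition maximal_correlation :: "('a \<Rightarrow> real) \<Rightarrow> ('a \<Rightarrow> real) \<Rightarrow> real" where
  "maximal_correlation X Y =
     Sup {covariance (\<lambda>\<omega>. \<phi> (X \<omega>)) (\<lambda>\<omega>. \<psi> (Y \<omega>)) /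
            sqrt (variance (\<lambda>\<omega>. \<phi> (X \<omega>)) * variance (\<lambda>\<omega>. \<psi> (Y \<omega>))) | \<phi> \<psi>.
          \<phi> \<in> borel_measurable borel \<and> \<psi> \<in> borel_measurable borel \<and>
          pos_finite_variance (\<lambda>\<omega>. \<phi> (X \<omega>)) \<and> pos_finite_variance (\<lambda>\<omega>. \<psi> (Y \<omega>))}"

text \<open>Geometric law on \<open>{1, 2, 3, \<dots>}\<close> (number of trials), unlike \<open>geometric_pmf\<close>, which
  counts the failures and starts at 0.\<close>

definition geometric_rv :: "('a \<Rightarrow> real) \<Rightarrow> real \<Rightarrow> bool" where
  "geometric_rv X p \<longleftrightarrow>
     random_variable borel X \<and>
     (AE \<omega> in M. \<exists>k::nat. 1 \<le> k \<and> X \<omega> = real k) \<and>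
     (\<forall>k::nat. 1 \<le> k \<longrightarrow> prob {\<omega> \<in> space M. X \<omega> = real k} = (1 - p) ^ (k - 1) * p)"

end

end

theory Submission
  imports Defs
begin

text \<open>
  Write \<open>Y\<close>, \<open>Z\<close> for the two minima and \<open>\<alpha> = P(Y > 1)\<close>, \<open>\<beta> = P(Z > 1)\<close>,
  \<open>\<gamma> = P(Y > 1, Z > 1)\<close>. The pair is memoryless: given \<open>Y > 1\<close> and \<open>Z > 1\<close>, the pair
  \<open>(Y - 1, Z - 1)\<close> has the law of \<open>(Y, Z)\<close>, and similarly for each minimum given that only the
  other one equals 1. Splitting on whether \<open>Y\<close> and \<open>Z\<close> exceed 1 gives, with
  \<open>x = f(1) - E f(Y + 1)\<close> and \<open>y = g(1) - E g(Z + 1)\<close>, the recursions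
  \<open>Var f(Y) = \<alpha>(1 - \<alpha>) x\<^sup>2 + \<alpha> Var f(Y + 1)\<close> and
  \<open>Cov(f(Y), g(Z)) = (\<gamma> - \<alpha>\<beta>) x y + \<gamma> Cov(f(Y + 1), g(Z + 1))\<close>. Let \<open>\<rho>\<close> be the claimed value, which is
  the correlation of the indicators of \<open>Y > 1\<close> and \<open>Z > 1\<close>, and let \<open>\<kappa> = \<gamma> / sqrt (\<alpha>\<beta>)\<close>.
  By Cauchy-Schwarz in the plane, an upper bound \<open>K\<close> for all correlations improves to
  \<open>max \<rho> (\<kappa> K)\<close>; starting from \<open>K = 1\<close> and iterating yields the bound \<open>\<rho>\<close> if \<open>\<kappa> < 1\<close>,
  while \<open>\<kappa> = 1\<close> forces \<open>\<rho> = 1\<close>.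
\<close>

no_notation Infinite_Sum.abs_summable_on (infixr \<open>abs'_summable'_on\<close> 46)

section \<open>Covariance of square-integrable random variables\<close>

lemma (in prob_space) square_integrable_mult:
  fixes U V :: "'a \<Rightarrow> real"
  assumes [measurable]: "random_variable borel U" "random_variable borel V"
    and "integrable M (\<lambda>x. (U x)\<^sup>2)" "integrable M (\<lambda>x. (V x)\<^sup>2)"
  shows "integrable M (\<lambda>x. U x * V x)"
proof (rule Bochner_Integration.integrable_bound)
  show "integrable M (\<lambda>x. (U x)\<^sup>2 + (V x)\<^sup>2)" using assms by auto
  have "\<bar>u * v\<bar> \<le> \<bar>u\<^sup>2 + v\<^sup>2\<bar>" for u v :: real
  proof -
    have "2 * \<bar>u * v\<bar> \<le> u\<^sup>2 + v\<^sup>2"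
      using sum_squares_bound[of "\<bar>u\<bar>" "\<bar>v\<bar>"] by (simp add: abs_mult mult.assoc)
    then show ?thesis by linarith
  qed
  then show "AE x in M. norm (U x * V x) \<le> norm ((U x)\<^sup>2 + (V x)\<^sup>2)" by simp
qed simp

lemma (in prob_space) covariance_eq:
  assumes "random_variable borel U" "random_variable borel V"
    and "integrable M (\<lambda>x. (U x)\<^sup>2)" "integrable M (\<lambda>x. (V x)\<^sup>2)"
  shows "covariance U V = expectation (\<lambda>x. U x * V x) - expectation U * expectation V"
proof -
  note [simp] = square_integrable_imp_integrable[OF assms(1,3)]
    square_integrable_imp_integrable[OF assms(2,4)] square_integrable_mult[OF assms]
  have "covariance U V = expectation (\<lambda>x. U x * V x - expectation U * V x - expectation V * U x
      + expectation U * expectation V)"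
    unfolding covariance_def by (intro Bochner_Integration.integral_cong) (auto simp: algebra_simps)
  then show ?thesis by (simp add: prob_space)
qed

text \<open>The second moment of \<open>s * u + t * v\<close>, for the centred variables
  \<open>u\<close> and \<open>v\<close>, is a nonnegative quadratic form in \<open>s\<close> and
  \<open>t\<close>; the inequality is its discriminant condition.\<close>

lemma (in prob_space) covariance_Cauchy_Schwarz:
  assumes [measurable]: "random_variable borel U" "random_variable borel V"
    and "integrable M (\<lambda>x. (U x)\<^sup>2)" "integrable M (\<lambda>x. (V x)\<^sup>2)"
  shows "(covariance U V)\<^sup>2 \<le> variance U * variance V"
proof -
  define u v where "u x = U x - expectation U" and "v x = V x - expectation V" for x
  have [measurable]: "random_variable borel u" "random_variable borel v"
    unfolding u_def v_def by measurable
  note [simp] = square_integrable_imp_integrable[OF assms(1,3)]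
    square_integrable_imp_integrable[OF assms(2,4)]
  have u2: "integrable M (\<lambda>x. (u x)\<^sup>2)" and v2: "integrable M (\<lambda>x. (v x)\<^sup>2)"
    unfolding u_def v_def power2_diff using assms by auto
  have uv: "integrable M (\<lambda>x. u x * v x)"
    by (intro square_integrable_mult u2 v2) auto
  define A B C where "A = expectation (\<lambda>x. (u x)\<^sup>2)" and "B = expectation (\<lambda>x. (v x)\<^sup>2)"
    and "C = expectation (\<lambda>x. u x * v x)"
  have quad: "0 \<le> s\<^sup>2 * A + 2 * s * t * C + t\<^sup>2 * B" for s t
  proof -
    have "0 \<le> expectation (\<lambda>x. (s * u x + t * v x)\<^sup>2)" by simp
    also have "\<dots> = expectation (\<lambda>x. s\<^sup>2 * (u x)\<^sup>2 + 2 * s * t * (u x * v x) + t\<^sup>2 * (v x)\<^sup>2)"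
      by (intro Bochner_Integration.integral_cong) (auto simp: power2_eq_square algebra_simps)
    also have "\<dots> = s\<^sup>2 * A + 2 * s * t * C + t\<^sup>2 * B"
      using u2 v2 uv by (simp add: A_def B_def C_def)
    finally show ?thesis .
  qed
  have "0 \<le> B" unfolding B_def by simp
  have "C\<^sup>2 \<le> A * B"
  proof (cases "B = 0")
    case True
    have "C = 0"
    proof (rule ccontr)
      assume "C \<noteq> 0"
      \<comment> \<open>For \<open>B = 0\<close> and \<open>s = 1\<close> the form is affine in
        \<open>t\<close>, and this \<open>t\<close> gives it the value
        \<open>A - (A + 1) = -1\<close>.\<close>
      then show False using quad[of 1 "- (A + 1) / (2 * C)"] True quad[of 1 0] by (simp add: field_simps)
    qed
    with True show ?thesis by simp
  next
    case False
    with \<open>0 \<le> B\<close> have "0 < B" by simp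
    \<comment> \<open>The choice \<open>s = B\<close>, \<open>t = - C\<close> minimises the form in
      \<open>t\<close> for that \<open>s\<close>.\<close>
    have "0 \<le> B * (A * B - C\<^sup>2)"
      using quad[of B "- C"] by (simp add: power2_eq_square algebra_simps)
    with \<open>0 < B\<close> show ?thesis by (simp add: zero_le_mult_iff)
  qed
  then show ?thesis
    by (simp add: A_def B_def C_def u_def v_def covariance_def)
qed

section \<open>Point masses of a memoryless pair\<close>

text \<open>Conditional laws enter in this form: on the range of \<open>h\<close>, \<open>p\<close>
  is \<open>c\<close> times the image of \<open>q\<close>. The sum formula includes
  \<open>c = 0\<close>, where both sides vanish even if the shifted function is not integrable under
  \<open>q\<close>; this covers \<beta> = \<gamma> and \<alpha> = \<gamma> below.\<close>

lemma
  fixes p :: "'a pmf" and q :: "'b pmf" and F :: "'a \<Rightarrow> real"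
  assumes h: "inj h" and c: "\<And>x. pmf p (h x) = c * pmf q x"
    and F: "integrable (measure_pmf p) F"
  shows infsetsum_pmf_range:
      "infsetsum (\<lambda>y. pmf p y * F y) (range h) = c * measure_pmf.expectation q (\<lambda>x. F (h x))"
    and integrable_pmf_comp: "c \<noteq> 0 \<Longrightarrow> integrable (measure_pmf q) (\<lambda>x. F (h x))"
proof -
  have *: "(\<lambda>y. pmf r y * G y) abs_summable_on UNIV \<longleftrightarrow> integrable (measure_pmf r) G"
    for r :: "'c pmf" and G :: "'c \<Rightarrow> real"
    unfolding abs_summable_on_def measure_pmf_eq_density by (subst integrable_density) auto
  have "(\<lambda>y. pmf p y * F y) abs_summable_on (range h)"
    by (rule abs_summable_on_subset[of _ UNIV]) (use F * in auto)
  then have s: "(\<lambda>x. c * (pmf q x * F (h x))) abs_summable_on UNIV"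
    using h by (subst (asm) abs_summable_on_reindex_iff[symmetric]) (auto simp: c mult.assoc)
  have s': "(\<lambda>x. pmf q x * F (h x)) abs_summable_on UNIV" if "c \<noteq> 0"
    using abs_summable_on_cmult_right[OF s, of "1/c"] that by simp
  show "c \<noteq> 0 \<Longrightarrow> integrable (measure_pmf q) (\<lambda>x. F (h x))" using s' * by blast
  show "infsetsum (\<lambda>y. pmf p y * F y) (range h) = c * measure_pmf.expectation q (\<lambda>x. F (h x))"
    unfolding pmf_expectation_eq_infsetsum using h s'
    by (subst infsetsum_reindex) (auto simp: c mult.assoc infsetsum_cmult_right)
qed

text \<open>The coordinates count from 0: they stand for \<open>Y - 1\<close> and \<open>Z - 1\<close>.\<close>

locale memoryless_pair =
  fixes J :: "(nat \<times> nat) pmf" and \<alpha> \<beta> \<gamma> :: real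
  assumes survival_Suc: "\<And>j k. measure_pmf.prob J ({Suc j..} \<times> {Suc k..}) =
      \<gamma> * measure_pmf.prob J ({j..} \<times> {k..})"
    and survival_fst: "\<And>j. measure_pmf.prob J ({j..} \<times> UNIV) = \<alpha> ^ j"
    and survival_snd: "\<And>k. measure_pmf.prob J (UNIV \<times> {k..}) = \<beta> ^ k"
    and \<alpha>: "0 < \<alpha>" "\<alpha> < 1" and \<beta>: "0 < \<beta>" "\<beta> < 1" and pos_corr: "\<alpha> * \<beta> \<le> \<gamma>"
begin

abbreviation "S j k \<equiv> measure_pmf.prob J ({j..} \<times> {k..})"

lemma survival_0: "S 0 k = \<beta> ^ k" "S j 0 = \<alpha> ^ j"
  using survival_fst survival_snd by (auto simp: atLeast_0)

text \<open>Inclusion-exclusion: a quadrant loses its corner when the two quadrants shifted by one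
  step are removed, and these meet in the diagonally shifted quadrant.\<close>

lemma pmf_survival: "pmf J (j, k) = S j k - S (Suc j) k - S j (Suc k) + S (Suc j) (Suc k)"
proof -
  have e: "{(j, k)} = ({j..} \<times> {k..}) - (({Suc j..} \<times> {k..}) \<union> ({j..} \<times> {Suc k..}))"
    by auto
  have i: "({Suc j..} \<times> {k..}) \<inter> ({j..} \<times> {Suc k..}) = {Suc j..} \<times> {Suc k..}" by auto
  have "pmf J (j, k) = S j k - measure_pmf.prob J (({Suc j..} \<times> {k..}) \<union> ({j..} \<times> {Suc k..}))"
    unfolding pmf.rep_eq by (subst e, rule measure_pmf.finite_measure_Diff) auto
  also have "measure_pmf.prob J (({Suc j..} \<times> {k..}) \<union> ({j..} \<times> {Suc k..})) =
      S (Suc j) k + S j (Suc k) - S (Suc j) (Suc k)"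
    by (subst measure_Un3) (auto simp: i fmeasurable_def measure_pmf.emeasure_eq_measure)
  finally show ?thesis by simp
qed

lemma pmf_fst: "pmf (map_pmf fst J) j = \<alpha> ^ j - \<alpha> ^ Suc j"
proof -
  have "fst -` {j} = ({j..} \<times> UNIV) - ({Suc j..} \<times> (UNIV :: nat set))" by auto
  then have "pmf (map_pmf fst J) j = measure_pmf.prob J (({j..} \<times> UNIV) - ({Suc j..} \<times> UNIV))"
    by (simp add: pmf_map)
  also have "\<dots> = \<alpha> ^ j - \<alpha> ^ Suc j"
    unfolding survival_fst[symmetric] by (rule measure_pmf.finite_measure_Diff) auto
  finally show ?thesis .
qed

lemma pmf_snd: "pmf (map_pmf snd J) k = \<beta> ^ k - \<beta> ^ Suc k"
proof -
  have "snd -` {k} = (UNIV \<times> {k..}) - ((UNIV :: nat set) \<times> {Suc k..})" by auto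
  then have "pmf (map_pmf snd J) k = measure_pmf.prob J ((UNIV \<times> {k..}) - (UNIV \<times> {Suc k..}))"
    by (simp add: pmf_map)
  also have "\<dots> = \<beta> ^ k - \<beta> ^ Suc k"
    unfolding survival_snd[symmetric] by (rule measure_pmf.finite_measure_Diff) auto
  finally show ?thesis .
qed

text \<open>Point masses are linear in the survival function, so they inherit its factor \<gamma>
  under a diagonal shift.\<close>

lemma pmf_Suc_Suc: "pmf J (Suc j, Suc k) = \<gamma> * pmf J (j, k)"
  by (simp add: pmf_survival survival_Suc algebra_simps)

text \<open>Here \<beta> - \<gamma> is the probability that only the first coordinate is 0. Given
  that event, the second coordinate minus one has the law of the second coordinate.\<close>

lemma pmf_0_Suc: "pmf J (0, Suc k) = (\<beta> - \<gamma>) * pmf (map_pmf snd J) k"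
  by (simp add: pmf_survival survival_Suc pmf_snd survival_0 survival_snd algebra_simps)

lemma pmf_Suc_0: "pmf J (Suc j, 0) = (\<alpha> - \<gamma>) * pmf (map_pmf fst J) j"
  by (simp add: pmf_survival survival_Suc pmf_fst survival_0 survival_fst algebra_simps)

lemma pmf_0_0: "pmf J (0, 0) = 1 - \<alpha> - \<beta> + \<gamma>"
  using survival_0[of 0] survival_0[of "Suc 0"] survival_0(2)[of "Suc 0"]
  by (simp add: pmf_survival survival_Suc)

lemma \<gamma>_pos: "0 < \<gamma>"
  using pos_corr \<alpha> \<beta> by (meson less_le_trans mult_pos_pos)

lemma \<gamma>_le: "\<gamma> \<le> \<alpha>" "\<gamma> \<le> \<beta>"
proof -
  have S: "\<gamma> = S (Suc 0) (Suc 0)" using survival_Suc[of 0 0] survival_0[of 0] by simp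
  have "S (Suc 0) (Suc 0) \<le> S (Suc 0) 0" "S (Suc 0) (Suc 0) \<le> S 0 (Suc 0)"
    by (intro measure_pmf.finite_measure_mono; auto)+
  with S show "\<gamma> \<le> \<alpha>" "\<gamma> \<le> \<beta>" using survival_0(2)[of "Suc 0"] survival_0(1)[of "Suc 0"] by simp_all
qed

section \<open>One-step recursions for moments\<close>

text \<open>The plane splits into the origin, the two axes without it, and the diagonally shifted
  quadrant. On each piece the mass is a constant times a law already known: that of one coordinate
  on an axis, that of the pair on the quadrant.\<close>

lemma expectation_recursion:
  fixes F :: "nat \<times> nat \<Rightarrow> real"
  assumes F: "integrable (measure_pmf J) F"
  shows "measure_pmf.expectation J F =
      (1 - \<alpha> - \<beta> + \<gamma>) * F (0, 0) +
      (\<beta> - \<gamma>) * measure_pmf.expectation J (\<lambda>x. F (0, Suc (snd x))) +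
      (\<alpha> - \<gamma>) * measure_pmf.expectation J (\<lambda>x. F (Suc (fst x), 0)) +
      \<gamma> * measure_pmf.expectation J (\<lambda>x. F (Suc (fst x), Suc (snd x)))"
proof -
  let ?w = "\<lambda>x. pmf J x * F x"
  let ?B = "range (\<lambda>k. (0::nat, Suc k))" and ?C = "range (\<lambda>j. (Suc j, 0::nat))"
  let ?D = "range (\<lambda>x. (Suc (fst x), Suc (snd x)))"
  have sm: "?w abs_summable_on A" for A
  proof (rule abs_summable_on_subset)
    show "?w abs_summable_on UNIV"
      using F unfolding abs_summable_on_def measure_pmf_eq_density
      by (subst (asm) integrable_density) auto
  qed simp
  have "(j, k) \<in> {(0, 0)} \<union> (?B \<union> (?C \<union> ?D))" for j k :: nat
    by (cases j; cases k) (auto simp: image_iff)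
  then have U: "UNIV = {(0, 0)} \<union> (?B \<union> (?C \<union> ?D))" by auto
  have "measure_pmf.expectation J F = infsetsum ?w UNIV" by (rule pmf_expectation_eq_infsetsum)
  also have "UNIV = {(0, 0)} \<union> (?B \<union> (?C \<union> ?D))" by (rule U)
  also have "infsetsum ?w \<dots> = ?w (0, 0) + (infsetsum ?w ?B + (infsetsum ?w ?C + infsetsum ?w ?D))"
  proof -
    have "infsetsum ?w (?C \<union> ?D) = infsetsum ?w ?C + infsetsum ?w ?D"
      by (rule infsetsum_Un_disjoint[OF sm sm]) auto
    moreover have "infsetsum ?w (?B \<union> (?C \<union> ?D)) = infsetsum ?w ?B + infsetsum ?w (?C \<union> ?D)"
      by (rule infsetsum_Un_disjoint[OF sm sm]) auto
    moreover have "infsetsum ?w ({(0, 0)} \<union> (?B \<union> (?C \<union> ?D))) =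
        infsetsum ?w {(0, 0)} + infsetsum ?w (?B \<union> (?C \<union> ?D))"
      by (rule infsetsum_Un_disjoint[OF sm sm]) auto
    ultimately show ?thesis by simp
  qed
  also have "infsetsum ?w ?B = (\<beta> - \<gamma>) * measure_pmf.expectation (map_pmf snd J) (\<lambda>k. F (0, Suc k))"
    by (rule infsetsum_pmf_range[OF _ _ F]) (auto simp: inj_on_def pmf_0_Suc)
  also have "infsetsum ?w ?C = (\<alpha> - \<gamma>) * measure_pmf.expectation (map_pmf fst J) (\<lambda>j. F (Suc j, 0))"
    by (rule infsetsum_pmf_range[OF _ _ F]) (auto simp: inj_on_def pmf_Suc_0)
  also have "infsetsum ?w ?D = \<gamma> * measure_pmf.expectation J (\<lambda>x. F (Suc (fst x), Suc (snd x)))"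
    by (rule infsetsum_pmf_range[OF _ _ F]) (auto simp: inj_on_def pmf_Suc_Suc)
  finally show ?thesis by (simp add: pmf_0_0)
qed

text \<open>Since \<gamma> > 0, the mass of the shifted quadrant controls the shifted function.
  Applied to functions of one coordinate, this keeps shifts square-integrable, so the recursions can
  be iterated.\<close>

lemma integrable_Suc_Suc:
  fixes F :: "nat \<times> nat \<Rightarrow> real"
  assumes F: "integrable (measure_pmf J) F"
  shows "integrable (measure_pmf J) (\<lambda>x. F (Suc (fst x), Suc (snd x)))"
  by (rule integrable_pmf_comp[OF _ _ F, where c = \<gamma>])
    (use \<gamma>_pos in \<open>auto simp: inj_on_def pmf_Suc_Suc\<close>)

lemma expectation_recursion_fst:
  fixes f :: "nat \<Rightarrow> real"
  assumes "integrable (measure_pmf J) (\<lambda>x. f (fst x))"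
  shows "measure_pmf.expectation J (\<lambda>x. f (fst x)) =
    (1 - \<alpha>) * f 0 + \<alpha> * measure_pmf.expectation J (\<lambda>x. f (Suc (fst x)))"
  using expectation_recursion[OF assms] by (simp add: algebra_simps)

lemma expectation_recursion_snd:
  fixes g :: "nat \<Rightarrow> real"
  assumes "integrable (measure_pmf J) (\<lambda>x. g (snd x))"
  shows "measure_pmf.expectation J (\<lambda>x. g (snd x)) =
    (1 - \<beta>) * g 0 + \<beta> * measure_pmf.expectation J (\<lambda>x. g (Suc (snd x)))"
  using expectation_recursion[OF assms] by (simp add: algebra_simps)

abbreviation "sq_int h \<equiv> integrable (measure_pmf J) (\<lambda>x. (h x :: real)\<^sup>2)"

lemma sq_int_integrable: "sq_int h \<Longrightarrow> integrable (measure_pmf J) h"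
  by (rule measure_pmf.square_integrable_imp_integrable) auto

text \<open>Law of total variance, given whether the first coordinate is 0: the first term is the
  variance between the two cases. Within the case 0 the variance vanishes.\<close>

lemma variance_recursion_fst:
  fixes f :: "nat \<Rightarrow> real"
  assumes f: "sq_int (\<lambda>x. f (fst x))"
  shows "measure_pmf.variance J (\<lambda>x. f (fst x)) =
    \<alpha> * (1 - \<alpha>) * (f 0 - measure_pmf.expectation J (\<lambda>x. f (Suc (fst x))))\<^sup>2 +
    \<alpha> * measure_pmf.variance J (\<lambda>x. f (Suc (fst x)))"
proof -
  note f' = integrable_Suc_Suc[OF f, simplified]
  show ?thesis
    unfolding measure_pmf.variance_eq[OF sq_int_integrable[OF f] f]
      measure_pmf.variance_eq[OF sq_int_integrable[OF f'] f']
    unfolding expectation_recursion_fst[OF sq_int_integrable[OF f]]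
      expectation_recursion_fst[of "\<lambda>j. (f j)\<^sup>2", OF f]
    by (simp add: power2_eq_square algebra_simps)
qed

lemma variance_recursion_snd:
  fixes g :: "nat \<Rightarrow> real"
  assumes g: "sq_int (\<lambda>x. g (snd x))"
  shows "measure_pmf.variance J (\<lambda>x. g (snd x)) =
    \<beta> * (1 - \<beta>) * (g 0 - measure_pmf.expectation J (\<lambda>x. g (Suc (snd x))))\<^sup>2 +
    \<beta> * measure_pmf.variance J (\<lambda>x. g (Suc (snd x)))"
proof -
  note g' = integrable_Suc_Suc[OF g, simplified]
  show ?thesis
    unfolding measure_pmf.variance_eq[OF sq_int_integrable[OF g] g]
      measure_pmf.variance_eq[OF sq_int_integrable[OF g'] g']
    unfolding expectation_recursion_snd[OF sq_int_integrable[OF g]]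
      expectation_recursion_snd[of "\<lambda>j. (g j)\<^sup>2", OF g]
    by (simp add: power2_eq_square algebra_simps)
qed

text \<open>On the axes one of the two factors is constant, so only the means of the shifted
  functions occur there. After subtracting the product of the means, what remains beside the shifted
  covariance depends only on the two differences.\<close>

lemma covariance_recursion:
  fixes f g :: "nat \<Rightarrow> real"
  assumes f: "sq_int (\<lambda>x. f (fst x))" and g: "sq_int (\<lambda>x. g (snd x))"
  shows "measure_pmf.covariance J (\<lambda>x. f (fst x)) (\<lambda>x. g (snd x)) =
    (\<gamma> - \<alpha> * \<beta>) * (f 0 - measure_pmf.expectation J (\<lambda>x. f (Suc (fst x))))
      * (g 0 - measure_pmf.expectation J (\<lambda>x. g (Suc (snd x)))) +
    \<gamma> * measure_pmf.covariance J (\<lambda>x. f (Suc (fst x))) (\<lambda>x. g (Suc (snd x)))"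
proof -
  note f' = integrable_Suc_Suc[OF f, simplified] and g' = integrable_Suc_Suc[OF g, simplified]
  have fg: "integrable (measure_pmf J) (\<lambda>x. f (fst x) * g (snd x))"
    by (rule measure_pmf.square_integrable_mult[OF _ _ f g]) auto
  show ?thesis
    unfolding measure_pmf.covariance_eq[OF _ _ f g, simplified]
      measure_pmf.covariance_eq[OF _ _ f' g', simplified]
    unfolding expectation_recursion_fst[OF sq_int_integrable[OF f]]
      expectation_recursion_snd[OF sq_int_integrable[OF g]]
      expectation_recursion[OF fg] fst_conv snd_conv
    by (simp add: algebra_simps)
qed

section \<open>The correlation bound by iteration\<close>

definition "\<rho> = (\<gamma> - \<alpha> * \<beta>) / sqrt (\<alpha> * (1 - \<alpha>) * \<beta> * (1 - \<beta>))"
definition "\<kappa> = \<gamma> / sqrt (\<alpha> * \<beta>)"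

text \<open>A product instead of a quotient admits functions of zero variance. They have to be
  covered because the shift of a non-constant function may be constant.\<close>

definition "corr_bound K \<longleftrightarrow> (\<forall>f g. sq_int (\<lambda>x. f (fst x)) \<longrightarrow> sq_int (\<lambda>x. g (snd x)) \<longrightarrow>
  measure_pmf.covariance J (\<lambda>x. f (fst x)) (\<lambda>x. g (snd x)) \<le>
  K * (sqrt (measure_pmf.variance J (\<lambda>x. f (fst x))) * sqrt (measure_pmf.variance J (\<lambda>x. g (snd x)))))"

lemma \<rho>_nonneg: "0 \<le> \<rho>"
  unfolding \<rho>_def using pos_corr \<alpha> \<beta> by simp

lemma corr_bound_1: "corr_bound 1"
  unfolding corr_bound_def
proof (intro allI impI)
  fix f g :: "nat \<Rightarrow> real"
  assume "sq_int (\<lambda>x. f (fst x))" "sq_int (\<lambda>x. g (snd x))"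
  then show "measure_pmf.covariance J (\<lambda>x. f (fst x)) (\<lambda>x. g (snd x)) \<le>
    1 * (sqrt (measure_pmf.variance J (\<lambda>x. f (fst x))) * sqrt (measure_pmf.variance J (\<lambda>x. g (snd x))))"
    unfolding mult_1 real_sqrt_mult[symmetric]
    by (intro real_le_rsqrt measure_pmf.covariance_Cauchy_Schwarz) auto
qed

lemma corr_bound_mono:
  assumes "corr_bound K" "K \<le> L"
  shows "corr_bound L"
  unfolding corr_bound_def
proof (intro allI impI)
  fix f g :: "nat \<Rightarrow> real"
  assume fg: "sq_int (\<lambda>x. f (fst x))" "sq_int (\<lambda>x. g (snd x))"
  let ?s = "sqrt (measure_pmf.variance J (\<lambda>x. f (fst x))) * sqrt (measure_pmf.variance J (\<lambda>x. g (snd x)))"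
  have "measure_pmf.covariance J (\<lambda>x. f (fst x)) (\<lambda>x. g (snd x)) \<le> K * ?s"
    using assms(1) fg unfolding corr_bound_def by blast
  also have "\<dots> \<le> L * ?s" using assms(2) by (intro mult_right_mono) auto
  finally show "measure_pmf.covariance J (\<lambda>x. f (fst x)) (\<lambda>x. g (snd x)) \<le> L * ?s" .
qed

lemma corr_bound_step:
  assumes K: "corr_bound K"
  shows "corr_bound (max \<rho> (\<kappa> * K))"
  unfolding corr_bound_def
proof (intro allI impI)
  fix f g :: "nat \<Rightarrow> real"
  assume f: "sq_int (\<lambda>x. f (fst x))" and g: "sq_int (\<lambda>x. g (snd x))"
  note f' = integrable_Suc_Suc[OF f, simplified] and g' = integrable_Suc_Suc[OF g, simplified]
  define x y where "x = f 0 - measure_pmf.expectation J (\<lambda>x. f (Suc (fst x)))"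
    and "y = g 0 - measure_pmf.expectation J (\<lambda>x. g (Suc (snd x)))"
  define V W where "V = measure_pmf.variance J (\<lambda>x. f (Suc (fst x)))"
    and "W = measure_pmf.variance J (\<lambda>x. g (Suc (snd x)))"
  have "0 \<le> V" "0 \<le> W" unfolding V_def W_def by simp_all
  let ?L = "max \<rho> (\<kappa> * K)"
  \<comment> \<open>The squares of \<open>u\<close> and \<open>u'\<close> are the two terms of the
    variance recursion for \<open>f\<close>, those of \<open>v\<close> and \<open>v'\<close> the
    terms for \<open>g\<close>. Hence the vectors \<open>(u, u')\<close> and \<open>(v, v')\<close>
    have the two standard deviations as lengths.\<close>
  define u u' v v' where "u = sqrt (\<alpha> * (1 - \<alpha>)) * \<bar>x\<bar>" and "u' = sqrt (\<alpha> * V)"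
    and "v = sqrt (\<beta> * (1 - \<beta>)) * \<bar>y\<bar>" and "v' = sqrt (\<beta> * W)"
  have nn: "0 \<le> u" "0 \<le> u'" "0 \<le> v" "0 \<le> v'"
    unfolding u_def u'_def v_def v'_def using \<alpha> \<beta> \<open>0 \<le> V\<close> \<open>0 \<le> W\<close> by simp_all
  have 1: "(\<gamma> - \<alpha> * \<beta>) * x * y \<le> \<rho> * (u * v)"
  proof -
    \<comment> \<open>Passing to absolute values is allowed because \<gamma> - \<alpha>\<beta> is
      nonnegative.\<close>
    have "(\<gamma> - \<alpha> * \<beta>) * (x * y) \<le> (\<gamma> - \<alpha> * \<beta>) * (\<bar>x\<bar> * \<bar>y\<bar>)"
      using pos_corr by (intro mult_left_mono) (auto simp flip: abs_mult)
    also have "\<dots> = \<rho> * (u * v)"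
      using \<alpha> \<beta> by (simp add: \<rho>_def u_def v_def real_sqrt_mult)
    finally show ?thesis by (simp add: mult.assoc)
  qed
  have 2: "\<gamma> * measure_pmf.covariance J (\<lambda>x. f (Suc (fst x))) (\<lambda>x. g (Suc (snd x))) \<le> \<kappa> * K * (u' * v')"
  proof -
    have "measure_pmf.covariance J (\<lambda>x. f (Suc (fst x))) (\<lambda>x. g (Suc (snd x))) \<le> K * (sqrt V * sqrt W)"
      using K f' g' unfolding corr_bound_def V_def W_def
      by (elim allE[of _ "\<lambda>j. f (Suc j)"] allE[of _ "\<lambda>j. g (Suc j)"]) auto
    then have "\<gamma> * measure_pmf.covariance J (\<lambda>x. f (Suc (fst x))) (\<lambda>x. g (Suc (snd x))) \<le>
        \<gamma> * (K * (sqrt V * sqrt W))"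
      using \<gamma>_pos by simp
    also have "\<dots> = \<kappa> * K * (u' * v')"
      using \<alpha> \<beta> by (simp add: \<kappa>_def u'_def v'_def real_sqrt_mult)
    finally show ?thesis .
  qed
  have CS: "u * v + u' * v' \<le> sqrt (u\<^sup>2 + u'\<^sup>2) * sqrt (v\<^sup>2 + v'\<^sup>2)"
  proof -
    have "0 \<le> (u * v' - u' * v)\<^sup>2" by simp
    then have "(u * v + u' * v')\<^sup>2 \<le> (u\<^sup>2 + u'\<^sup>2) * (v\<^sup>2 + v'\<^sup>2)"
      by (simp add: power2_eq_square algebra_simps)
    then show ?thesis unfolding real_sqrt_mult[symmetric] by (rule real_le_rsqrt)
  qed
  have "measure_pmf.covariance J (\<lambda>x. f (fst x)) (\<lambda>x. g (snd x)) \<le> \<rho> * (u * v) + \<kappa> * K * (u' * v')"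
    unfolding covariance_recursion[OF f g] using 1 2 by (simp add: x_def y_def)
  also have "\<dots> \<le> ?L * (u * v) + ?L * (u' * v')"
    using nn by (intro add_mono mult_right_mono) auto
  \<comment> \<open>The factor \<open>?L\<close> is nonnegative because it is at least \<rho>,
    whatever the sign of \<open>K\<close>.\<close>
  also have "\<dots> \<le> ?L * (sqrt (u\<^sup>2 + u'\<^sup>2) * sqrt (v\<^sup>2 + v'\<^sup>2))"
    unfolding distrib_left[symmetric] using CS \<rho>_nonneg by (intro mult_left_mono) auto
  also have "u\<^sup>2 + u'\<^sup>2 = measure_pmf.variance J (\<lambda>x. f (fst x))"
    unfolding variance_recursion_fst[OF f] u_def u'_def x_def[symmetric] V_def[symmetric]
    using \<alpha> \<open>0 \<le> V\<close> by (simp add: power_mult_distrib)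
  also have "v\<^sup>2 + v'\<^sup>2 = measure_pmf.variance J (\<lambda>x. g (snd x))"
    unfolding variance_recursion_snd[OF g] v_def v'_def y_def[symmetric] W_def[symmetric]
    using \<beta> \<open>0 \<le> W\<close> by (simp add: power_mult_distrib)
  finally show "measure_pmf.covariance J (\<lambda>x. f (fst x)) (\<lambda>x. g (snd x)) \<le>
    ?L * (sqrt (measure_pmf.variance J (\<lambda>x. f (fst x))) * sqrt (measure_pmf.variance J (\<lambda>x. g (snd x))))" .
qed

lemma \<kappa>_bounds: "0 < \<kappa>" "\<kappa> \<le> 1"
proof -
  show "0 < \<kappa>" unfolding \<kappa>_def using \<gamma>_pos \<alpha> \<beta> by simp
  have "\<gamma>\<^sup>2 \<le> \<alpha> * \<beta>" using \<gamma>_le \<gamma>_pos \<alpha> by (simp add: power2_eq_square mult_mono)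
  then have "\<gamma> \<le> sqrt (\<alpha> * \<beta>)" by (rule real_le_rsqrt)
  then show "\<kappa> \<le> 1" unfolding \<kappa>_def using \<alpha> \<beta> by simp
qed

text \<open>Together with \<gamma> \<le> \<alpha> and \<gamma> \<le> \<beta>, the equality
  \<gamma>\<gamma> = \<alpha>\<beta> forces \<alpha> = \<beta> = \<gamma>. The events that the
  coordinates are positive then agree up to a null set.\<close>

lemma \<kappa>_1_imp_\<rho>_1:
  assumes "\<kappa> = 1"
  shows "\<rho> = 1"
proof -
  have "0 < sqrt (\<alpha> * \<beta>)" using \<alpha> \<beta> by simp
  then have "\<gamma> = sqrt (\<alpha> * \<beta>)" using assms by (simp add: \<kappa>_def field_simps)
  then have g: "\<gamma> * \<gamma> = \<alpha> * \<beta>" using \<alpha> \<beta> by simp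
  have "\<gamma> * \<gamma> \<le> \<gamma> * \<beta>" "\<gamma> * \<gamma> \<le> \<alpha> * \<gamma>" using \<gamma>_le \<gamma>_pos by simp_all
  with g have "\<alpha> * \<beta> \<le> \<gamma> * \<beta>" "\<alpha> * \<beta> \<le> \<alpha> * \<gamma>" by simp_all
  then have eq: "\<alpha> = \<gamma>" "\<beta> = \<gamma>" using \<gamma>_le \<alpha> \<beta> by simp_all
  have "sqrt (\<alpha> * (1 - \<alpha>) * \<beta> * (1 - \<beta>)) = sqrt ((\<gamma> * (1 - \<gamma>))\<^sup>2)"
    by (simp add: eq power2_eq_square mult_ac)
  also have "\<dots> = \<gamma> * (1 - \<gamma>)" using \<alpha> eq by simp
  finally have "\<rho> = (\<gamma> - \<gamma> * \<gamma>) / (\<gamma> * (1 - \<gamma>))"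
    unfolding \<rho>_def by (simp add: eq)
  moreover have "\<gamma> * (1 - \<gamma>) \<noteq> 0" using \<alpha> eq by simp
  ultimately show ?thesis by (simp add: right_diff_distrib)
qed

lemma corr_bound_\<rho>: "corr_bound \<rho>"
proof (cases "\<kappa> = 1")
  case True
  then show ?thesis using \<kappa>_1_imp_\<rho>_1 corr_bound_1 by simp
next
  case False
  have pow: "corr_bound (max \<rho> (\<kappa> ^ i))" for i
  proof (induction i)
    case 0
    have "max \<rho> (\<kappa> ^ 0) \<ge> 1" by simp
    with corr_bound_1 show ?case by (rule corr_bound_mono)
  next
    case (Suc i)
    \<comment> \<open>The term \<kappa>\<rho> is absorbed by \<rho>, so only the power of \<kappa>
      changes from one round to the next.\<close>
    have "\<kappa> * \<rho> \<le> \<rho>" using \<kappa>_bounds \<rho>_nonneg by (simp add: mult_left_le_one_le)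
    moreover have "\<kappa> * max \<rho> (\<kappa> ^ i) = max (\<kappa> * \<rho>) (\<kappa> ^ Suc i)"
      using \<kappa>_bounds by (simp add: max_mult_distrib_left)
    ultimately have "max \<rho> (\<kappa> * max \<rho> (\<kappa> ^ i)) = max \<rho> (\<kappa> ^ Suc i)" by simp
    then show ?case using corr_bound_step[OF Suc] by simp
  qed
  have "(\<lambda>i. \<kappa> ^ i) \<longlonglongrightarrow> 0" using \<kappa>_bounds False by (intro LIMSEQ_power_zero) auto
  then have lim: "(\<lambda>i. max \<rho> (\<kappa> ^ i)) \<longlonglongrightarrow> max \<rho> 0" by (intro tendsto_max tendsto_const)
  show ?thesis
    unfolding corr_bound_def
  proof (intro allI impI)
    fix f g :: "nat \<Rightarrow> real"
    assume fg: "sq_int (\<lambda>x. f (fst x))" "sq_int (\<lambda>x. g (snd x))"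
    let ?s = "sqrt (measure_pmf.variance J (\<lambda>x. f (fst x))) * sqrt (measure_pmf.variance J (\<lambda>x. g (snd x)))"
    have "(\<lambda>i. max \<rho> (\<kappa> ^ i) * ?s) \<longlonglongrightarrow> max \<rho> 0 * ?s" by (intro tendsto_mult lim tendsto_const)
    then have "measure_pmf.covariance J (\<lambda>x. f (fst x)) (\<lambda>x. g (snd x)) \<le> max \<rho> 0 * ?s"
      by (rule LIMSEQ_le_const) (use pow fg in \<open>auto simp: corr_bound_def\<close>)
    then show "measure_pmf.covariance J (\<lambda>x. f (fst x)) (\<lambda>x. g (snd x)) \<le> \<rho> * ?s"
      using \<rho>_nonneg by simp
  qed
qed

text \<open>These functions attain \<rho>. Shifted by one they are constant, so each recursion stops
  after one step, with both differences equal to -1.\<close>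

lemma indicator_moments:
  fixes f :: "nat \<Rightarrow> real"
  defines "f \<equiv> \<lambda>j. if j = 0 then 0 else 1"
  shows "measure_pmf.variance J (\<lambda>x. f (fst x)) = \<alpha> * (1 - \<alpha>)"
    and "measure_pmf.variance J (\<lambda>x. f (snd x)) = \<beta> * (1 - \<beta>)"
    and "measure_pmf.covariance J (\<lambda>x. f (fst x)) (\<lambda>x. f (snd x)) = \<gamma> - \<alpha> * \<beta>"
proof -
  have int: "sq_int (\<lambda>x. f (fst x))" "sq_int (\<lambda>x. f (snd x))"
    by (rule measure_pmf.integrable_const_bound[where B = 1]; simp add: f_def)+
  show "measure_pmf.variance J (\<lambda>x. f (fst x)) = \<alpha> * (1 - \<alpha>)"
    unfolding variance_recursion_fst[OF int(1)] by (simp add: f_def)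
  show "measure_pmf.variance J (\<lambda>x. f (snd x)) = \<beta> * (1 - \<beta>)"
    unfolding variance_recursion_snd[OF int(2)] by (simp add: f_def)
  show "measure_pmf.covariance J (\<lambda>x. f (fst x)) (\<lambda>x. f (snd x)) = \<gamma> - \<alpha> * \<beta>"
    unfolding covariance_recursion[OF int] by (simp add: f_def measure_pmf.covariance_def)
qed

end

section \<open>Transfer to an arbitrary probability space\<close>

lemma (in prob_space) ex_pmf_distr:
  fixes T :: "'a \<Rightarrow> 'b :: countable"
  assumes T: "T \<in> measurable M (count_space UNIV)"
  shows "\<exists>J. measure_pmf J = distr M (count_space UNIV) T"
proof -
  let ?D = "distr M (count_space UNIV) T"
  interpret D: prob_space ?D using T by (rule prob_space_distr)
  \<comment> \<open>On a countable type the points of mass zero form a null set.\<close>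
  have "AE x in ?D. measure ?D {x} \<noteq> 0"
    by (subst D.AE_support_countable) (auto intro: exI[of _ UNIV])
  then have "measure_pmf (Abs_pmf ?D) = ?D"
    by (intro Abs_pmf_inverse) (auto intro: D.prob_space_axioms)
  then show ?thesis by blast
qed

text \<open>Almost surely, exceeding \<open>t\<close> means either exceeding \<open>t + 1\<close> or
  being equal to \<open>t + 1\<close>. The atom at \<open>t + 1\<close> has mass
  \<open>(1 - p) ^ t * p\<close>.\<close>

lemma (in prob_space) geometric_rv_survival:
  assumes "geometric_rv X p"
  shows "prob {\<omega> \<in> space M. real t < X \<omega>} = (1 - p) ^ t"
proof (induction t)
  have [measurable]: "random_variable borel X" and ae: "AE \<omega> in M. \<exists>k::nat. 1 \<le> k \<and> X \<omega> = real k"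
    using assms by (auto simp: geometric_rv_def)
  {
    case 0
    have "AE \<omega> in M. 0 < X \<omega>" using ae by eventually_elim auto
    then have "prob {\<omega> \<in> space M. 0 < X \<omega>} = 1" by (subst prob_Collect_eq_1) auto
    then show ?case by simp
  next
    case (Suc t)
    have "prob {\<omega> \<in> space M. real t < X \<omega>} =
        prob ({\<omega> \<in> space M. real (Suc t) < X \<omega>} \<union> {\<omega> \<in> space M. X \<omega> = real (Suc t)})"
    proof (rule finite_measure_eq_AE)
      show "AE \<omega> in M. (\<omega> \<in> {\<omega> \<in> space M. real t < X \<omega>}) =
          (\<omega> \<in> {\<omega> \<in> space M. real (Suc t) < X \<omega>} \<union> {\<omega> \<in> space M. X \<omega> = real (Suc t)})"
        using ae by eventually_elim auto
    qed measurable
    also have "\<dots> = prob {\<omega> \<in> space M. real (Suc t) < X \<omega>} + prob {\<omega> \<in> space M. X \<omega> = real (Suc t)}"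
      by (rule finite_measure_Union) auto
    also have "prob {\<omega> \<in> space M. X \<omega> = real (Suc t)} = (1 - p) ^ t * p"
      using assms unfolding geometric_rv_def by (metis diff_Suc_1 le_add1 plus_1_eq_Suc)
    finally show ?case using Suc.IH by (simp add: algebra_simps)
  }
qed

text \<open>All moments are carried over to the law of the pair counted from 0, where the bound is
  known. The almost sure condition that the other variable is positive makes each one-variable
  hypothesis an instance of joint survival.\<close>

lemma (in prob_space) maximal_correlation_memoryless:
  fixes Y Z :: "'a \<Rightarrow> real" and \<alpha> \<beta> \<gamma> :: real
  assumes Y[measurable]: "random_variable borel Y" and Z[measurable]: "random_variable borel Z"
    and Y_nat: "AE \<omega> in M. \<exists>k::nat. 1 \<le> k \<and> Y \<omega> = real k"
    and Z_nat: "AE \<omega> in M. \<exists>k::nat. 1 \<le> k \<and> Z \<omega> = real k"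
    and surv_Suc: "\<And>j k. prob {\<omega> \<in> space M. real (Suc j) < Y \<omega> \<and> real (Suc k) < Z \<omega>} =
      \<gamma> * prob {\<omega> \<in> space M. real j < Y \<omega> \<and> real k < Z \<omega>}"
    and surv_Y: "\<And>j. prob {\<omega> \<in> space M. real j < Y \<omega> \<and> 0 < Z \<omega>} = \<alpha> ^ j"
    and surv_Z: "\<And>k. prob {\<omega> \<in> space M. 0 < Y \<omega> \<and> real k < Z \<omega>} = \<beta> ^ k"
    and \<alpha>: "0 < \<alpha>" "\<alpha> < 1" and \<beta>: "0 < \<beta>" "\<beta> < 1" and "\<alpha> * \<beta> \<le> \<gamma>"
  shows "maximal_correlation Y Z = (\<gamma> - \<alpha> * \<beta>) / sqrt (\<alpha> * (1 - \<alpha>) * \<beta> * (1 - \<beta>))"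
proof -
  \<comment> \<open>Rounding gives measurable functions into the naturals that are defined
    everywhere; they equal \<open>Y - 1\<close> and \<open>Z - 1\<close> only almost surely.\<close>
  define A B where "A \<omega> = nat \<lceil>Y \<omega>\<rceil> - 1" and "B \<omega> = nat \<lceil>Z \<omega>\<rceil> - 1" for \<omega>
  have [measurable]: "A \<in> measurable M (count_space UNIV)" "B \<in> measurable M (count_space UNIV)"
    unfolding A_def B_def by measurable
  have AB[measurable]: "(\<lambda>\<omega>. (A \<omega>, B \<omega>)) \<in> measurable M (count_space UNIV)"
    by measurable
  have YA: "AE \<omega> in M. Y \<omega> = real (Suc (A \<omega>))"
    using Y_nat by eventually_elim (auto simp: A_def)
  have ZB: "AE \<omega> in M. Z \<omega> = real (Suc (B \<omega>))"
    using Z_nat by eventually_elim (auto simp: B_def)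
  obtain J where J: "measure_pmf J = distr M (count_space UNIV) (\<lambda>\<omega>. (A \<omega>, B \<omega>))"
    using ex_pmf_distr[OF AB] by blast
  \<comment> \<open>The offset by one turns the strict \<open>real j < Y\<close> into the weak
    condition that \<open>A\<close> is at least \<open>j\<close>.\<close>
  have surv: "measure_pmf.prob J ({j..} \<times> {k..}) = prob {\<omega> \<in> space M. real j < Y \<omega> \<and> real k < Z \<omega>}" for j k
  proof -
    have "measure_pmf.prob J ({j..} \<times> {k..}) = prob ((\<lambda>\<omega>. (A \<omega>, B \<omega>)) -` ({j..} \<times> {k..}) \<inter> space M)"
      unfolding J by (rule measure_distr) auto
    also have "\<dots> = prob {\<omega> \<in> space M. real j < Y \<omega> \<and> real k < Z \<omega>}"
    proof (rule finite_measure_eq_AE)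
      show "AE \<omega> in M. (\<omega> \<in> (\<lambda>\<omega>. (A \<omega>, B \<omega>)) -` ({j..} \<times> {k..}) \<inter> space M) =
          (\<omega> \<in> {\<omega> \<in> space M. real j < Y \<omega> \<and> real k < Z \<omega>})"
        using YA ZB by eventually_elim auto
    qed auto
    finally show ?thesis .
  qed
  interpret memoryless_pair J \<alpha> \<beta> \<gamma>
  proof
    show "measure_pmf.prob J ({j..} \<times> UNIV) = \<alpha> ^ j" for j
      using surv[of j 0] surv_Y[of j] by simp
    show "measure_pmf.prob J (UNIV \<times> {k..}) = \<beta> ^ k" for k
      using surv[of 0 k] surv_Z[of k] by simp
  qed (use assms surv in auto)
  have E: "measure_pmf.expectation J F = expectation (\<lambda>\<omega>. F (A \<omega>, B \<omega>))" for F :: "nat \<times> nat \<Rightarrow> real"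
    unfolding J by (rule integral_distr) auto
  have I: "integrable (measure_pmf J) F \<longleftrightarrow> integrable M (\<lambda>\<omega>. F (A \<omega>, B \<omega>))" for F :: "nat \<times> nat \<Rightarrow> real"
    unfolding J by (rule integrable_distr_eq) auto
  define sh where "sh \<phi> j = \<phi> (real (Suc j))" for \<phi> :: "real \<Rightarrow> real" and j
  have expectation_cong: "expectation f = expectation g"
    if "AE \<omega> in M. f \<omega> = g \<omega>" "random_variable borel f" "random_variable borel g"
    for f g :: "'a \<Rightarrow> real"
    using that by (intro integral_cong_AE)
  have EY: "expectation (\<lambda>\<omega>. \<phi> (Y \<omega>)) = measure_pmf.expectation J (\<lambda>x. sh \<phi> (fst x))"
    and EZ: "expectation (\<lambda>\<omega>. \<phi> (Z \<omega>)) = measure_pmf.expectation J (\<lambda>x. sh \<phi> (snd x))"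
    if [measurable]: "\<phi> \<in> borel_measurable borel" for \<phi>
    unfolding E sh_def fst_conv snd_conv using YA ZB
    by (intro expectation_cong; measurable?; eventually_elim; simp)+
  have VY: "variance (\<lambda>\<omega>. \<phi> (Y \<omega>)) = measure_pmf.variance J (\<lambda>x. sh \<phi> (fst x))"
    and VZ: "variance (\<lambda>\<omega>. \<phi> (Z \<omega>)) = measure_pmf.variance J (\<lambda>x. sh \<phi> (snd x))"
    if [measurable]: "\<phi> \<in> borel_measurable borel" for \<phi>
    \<comment> \<open>The transfer is applied to the squared deviation from an arbitrary constant,
      which then becomes the mean.\<close>
    using EY[of "\<lambda>x. (\<phi> x - c)\<^sup>2" for c] EZ[of "\<lambda>x. (\<phi> x - c)\<^sup>2" for c]
    by (simp_all add: EY EZ sh_def)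
  have C: "covariance (\<lambda>\<omega>. \<phi> (Y \<omega>)) (\<lambda>\<omega>. \<psi> (Z \<omega>)) =
      measure_pmf.covariance J (\<lambda>x. sh \<phi> (fst x)) (\<lambda>x. sh \<psi> (snd x))"
    if [measurable]: "\<phi> \<in> borel_measurable borel" "\<psi> \<in> borel_measurable borel" for \<phi> \<psi>
  proof -
    define a b where "a = expectation (\<lambda>\<omega>. \<phi> (Y \<omega>))" and "b = expectation (\<lambda>\<omega>. \<psi> (Z \<omega>))"
    have "expectation (\<lambda>\<omega>. (\<phi> (Y \<omega>) - a) * (\<psi> (Z \<omega>) - b)) =
        expectation (\<lambda>\<omega>. (sh \<phi> (A \<omega>) - a) * (sh \<psi> (B \<omega>) - b))"
    proof (rule expectation_cong)
      show "AE \<omega> in M. (\<phi> (Y \<omega>) - a) * (\<psi> (Z \<omega>) - b) = (sh \<phi> (A \<omega>) - a) * (sh \<psi> (B \<omega>) - b)"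
        using YA ZB by eventually_elim (simp add: sh_def)
    qed (simp_all add: sh_def)
    then show ?thesis
      unfolding covariance_def measure_pmf.covariance_def EY[OF that(1), symmetric]
        EZ[OF that(2), symmetric] a_def[symmetric] b_def[symmetric]
      by (simp add: E)
  qed
  have SY: "integrable M (\<lambda>\<omega>. (\<phi> (Y \<omega>))\<^sup>2) \<longleftrightarrow> sq_int (\<lambda>x. sh \<phi> (fst x))"
    and SZ: "integrable M (\<lambda>\<omega>. (\<phi> (Z \<omega>))\<^sup>2) \<longleftrightarrow> sq_int (\<lambda>x. sh \<phi> (snd x))"
    if [measurable]: "\<phi> \<in> borel_measurable borel" for \<phi>
    unfolding I sh_def fst_conv snd_conv using YA ZB
    by (intro integrable_cong_AE; measurable?; eventually_elim; simp)+
  have "maximal_correlation Y Z = \<rho>"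
    unfolding maximal_correlation_def
  proof (rule cSup_eq_maximum)
    \<comment> \<open>The supremum is attained at the indicator of values above 1, which
      \<open>sh\<close> turns into the function of \<open>indicator_moments\<close>.\<close>
    define \<phi> where "\<phi> x = (if x > 1 then 1 else 0 :: real)" for x :: real
    have \<phi>[measurable]: "\<phi> \<in> borel_measurable borel" unfolding \<phi>_def by measurable
    have sh: "sh \<phi> = (\<lambda>j. if j = 0 then 0 else 1)" by (auto simp: sh_def \<phi>_def fun_eq_iff)
    have int: "integrable M (\<lambda>\<omega>. (\<phi> (Y \<omega>))\<^sup>2)" "integrable M (\<lambda>\<omega>. (\<phi> (Z \<omega>))\<^sup>2)"
      by (rule integrable_const_bound[where B = 1]; simp add: \<phi>_def)+
    have v: "variance (\<lambda>\<omega>. \<phi> (Y \<omega>)) = \<alpha> * (1 - \<alpha>)" "variance (\<lambda>\<omega>. \<phi> (Z \<omega>)) = \<beta> * (1 - \<beta>)"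
      "covariance (\<lambda>\<omega>. \<phi> (Y \<omega>)) (\<lambda>\<omega>. \<phi> (Z \<omega>)) = \<gamma> - \<alpha> * \<beta>"
      unfolding VY[OF \<phi>] VZ[OF \<phi>] C[OF \<phi> \<phi>] sh by (rule indicator_moments)+
    have "pos_finite_variance (\<lambda>\<omega>. \<phi> (Y \<omega>))" "pos_finite_variance (\<lambda>\<omega>. \<phi> (Z \<omega>))"
      unfolding pos_finite_variance_def v using int \<alpha> \<beta> by auto
    moreover have "\<rho> = covariance (\<lambda>\<omega>. \<phi> (Y \<omega>)) (\<lambda>\<omega>. \<phi> (Z \<omega>)) /
        sqrt (variance (\<lambda>\<omega>. \<phi> (Y \<omega>)) * variance (\<lambda>\<omega>. \<phi> (Z \<omega>)))"
      unfolding v \<rho>_def by (simp add: mult.assoc)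
    ultimately show "\<rho> \<in> {covariance (\<lambda>\<omega>. \<phi> (Y \<omega>)) (\<lambda>\<omega>. \<psi> (Z \<omega>)) /
        sqrt (variance (\<lambda>\<omega>. \<phi> (Y \<omega>)) * variance (\<lambda>\<omega>. \<psi> (Z \<omega>))) | \<phi> \<psi>.
          \<phi> \<in> borel_measurable borel \<and> \<psi> \<in> borel_measurable borel \<and>
          pos_finite_variance (\<lambda>\<omega>. \<phi> (Y \<omega>)) \<and> pos_finite_variance (\<lambda>\<omega>. \<psi> (Z \<omega>))}"
      using \<phi> by blast
  next
    fix r
    assume "r \<in> {covariance (\<lambda>\<omega>. \<phi> (Y \<omega>)) (\<lambda>\<omega>. \<psi> (Z \<omega>)) /
        sqrt (variance (\<lambda>\<omega>. \<phi> (Y \<omega>)) * variance (\<lambda>\<omega>. \<psi> (Z \<omega>))) | \<phi> \<psi>.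
          \<phi> \<in> borel_measurable borel \<and> \<psi> \<in> borel_measurable borel \<and>
          pos_finite_variance (\<lambda>\<omega>. \<phi> (Y \<omega>)) \<and> pos_finite_variance (\<lambda>\<omega>. \<psi> (Z \<omega>))}"
    then obtain \<phi> \<psi> where r: "r = covariance (\<lambda>\<omega>. \<phi> (Y \<omega>)) (\<lambda>\<omega>. \<psi> (Z \<omega>)) /
        sqrt (variance (\<lambda>\<omega>. \<phi> (Y \<omega>)) * variance (\<lambda>\<omega>. \<psi> (Z \<omega>)))"
      and m: "\<phi> \<in> borel_measurable borel" "\<psi> \<in> borel_measurable borel"
      and fin: "pos_finite_variance (\<lambda>\<omega>. \<phi> (Y \<omega>))" "pos_finite_variance (\<lambda>\<omega>. \<psi> (Z \<omega>))"
      by blast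
    have "covariance (\<lambda>\<omega>. \<phi> (Y \<omega>)) (\<lambda>\<omega>. \<psi> (Z \<omega>)) \<le>
        \<rho> * (sqrt (variance (\<lambda>\<omega>. \<phi> (Y \<omega>))) * sqrt (variance (\<lambda>\<omega>. \<psi> (Z \<omega>))))"
      using corr_bound_\<rho> fin unfolding corr_bound_def pos_finite_variance_def
        C[OF m] VY[OF m(1)] VZ[OF m(2)] SY[OF m(1)] SZ[OF m(2)] by blast
    moreover have "0 < sqrt (variance (\<lambda>\<omega>. \<phi> (Y \<omega>)) * variance (\<lambda>\<omega>. \<psi> (Z \<omega>)))"
      using fin unfolding pos_finite_variance_def by simp
    ultimately show "r \<le> \<rho>"
      unfolding r by (simp add: pos_divide_le_eq real_sqrt_mult)
  qed
  then show ?thesis by (simp only: \<rho>_def)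
qed

section \<open>Minima of independent geometric variables\<close>

lemma prod_less_1_real:
  fixes q :: "'i \<Rightarrow> real"
  assumes "finite I" "I \<noteq> {}" "\<And>i. i \<in> I \<Longrightarrow> 0 < q i \<and> q i < 1"
  shows "prod q I < 1"
proof -
  obtain i where i: "i \<in> I" using assms by blast
  have "prod q (I - {i}) \<le> 1" using assms by (intro prod_le_1) (auto intro: less_imp_le)
  then have "q i * prod q (I - {i}) \<le> q i * 1"
    using assms(3)[OF i] by (intro mult_left_mono) auto
  then show ?thesis using assms(3)[OF i] prod.remove[OF \<open>finite I\<close> i, of q] by linarith
qed

lemma (in prob_space) AE_Min_nat:
  fixes X :: "'i \<Rightarrow> 'a \<Rightarrow> real"
  assumes "finite I" "I \<noteq> {}" "\<And>i. i \<in> I \<Longrightarrow> AE \<omega> in M. \<exists>k::nat. 1 \<le> k \<and> X i \<omega> = real k"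
  shows "AE \<omega> in M. \<exists>k::nat. 1 \<le> k \<and> (MIN i\<in>I. X i \<omega>) = real k"
proof -
  have "AE \<omega> in M. \<forall>i\<in>I. \<exists>k::nat. 1 \<le> k \<and> X i \<omega> = real k"
    using assms by (subst AE_ball_countable) (auto intro: countable_finite)
  then show ?thesis
  proof eventually_elim
    case (elim \<omega>)
    have "(MIN i\<in>I. X i \<omega>) \<in> (\<lambda>i. X i \<omega>) ` I" using assms by (intro Min_in) auto
    then show ?case using elim by auto
  qed
qed

theorem theorem1p4:
  fixes M :: "'a measure" and X :: "nat \<Rightarrow> 'a \<Rightarrow> real" and p :: "nat \<Rightarrow> real"
    and n m l :: nat
  assumes "prob_space M"
    and "1 \<le> l + 1" and "l + 1 \<le> m" and "m \<le> n"
    and "\<And>i. i \<in> {1..n} \<Longrightarrow> p i \<in> {0<..<1}"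
    and "\<And>i. i \<in> {1..n} \<Longrightarrow> prob_space.geometric_rv M (X i) (p i)"
    and "prob_space.indep_vars M (\<lambda>_. borel) X {1..n}"
  shows "prob_space.maximal_correlation M
           (\<lambda>\<omega>. MIN i\<in>{1..m}. X i \<omega>) (\<lambda>\<omega>. MIN j\<in>{l+1..n}. X j \<omega>) =
         ((\<Prod>i=1..n. 1 - p i) - (\<Prod>i=1..m. 1 - p i) * (\<Prod>i=l+1..n. 1 - p i)) /
         sqrt ((\<Prod>i=1..m. 1 - p i) * (1 - (\<Prod>i=1..m. 1 - p i)) *
               (\<Prod>i=l+1..n. 1 - p i) * (1 - (\<Prod>i=l+1..n. 1 - p i))) \<and>
         (n = 3 \<and> m = 2 \<and> l = 1 \<longrightarrow>
         prob_space.maximal_correlation M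
           (\<lambda>\<omega>. min (X 1 \<omega>) (X 2 \<omega>)) (\<lambda>\<omega>. min (X 2 \<omega>) (X 3 \<omega>)) =
         sqrt ((1 - p 1) * (1 - p 3)) * p 2 /
         sqrt ((1 - (1 - p 1) * (1 - p 2)) * (1 - (1 - p 2) * (1 - p 3))))"
proof -
  interpret prob_space M by fact
  let ?Y = "\<lambda>\<omega>. MIN i\<in>{1..m}. X i \<omega>" and ?Z = "\<lambda>\<omega>. MIN j\<in>{l+1..n}. X j \<omega>"
  let ?\<alpha> = "\<Prod>i=1..m. 1 - p i" and ?\<beta> = "\<Prod>i=l+1..n. 1 - p i" and ?\<gamma> = "\<Prod>i=1..n. 1 - p i"
  have p: "0 < p i" "p i < 1" if "i \<in> {1..n}" for i using assms(5)[OF that] by auto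
  have X[measurable]: "random_variable borel (X i)"
    and X_nat: "AE \<omega> in M. \<exists>k::nat. 1 \<le> k \<and> X i \<omega> = real k" if "i \<in> {1..n}" for i
    using assms(6)[OF that] by (auto simp: geometric_rv_def)
  \<comment> \<open>The threshold that \<open>X i\<close> has to exceed: \<open>j\<close> if
    \<open>i\<close> belongs to the first block, \<open>k\<close> if to the second, the larger one
    if to both. The value 0 imposes no condition almost surely.\<close>
  let ?t = "\<lambda>j k i. max (if i \<le> m then j else 0) (if l < i then k else 0 :: nat)"
  have surv: "prob {\<omega> \<in> space M. real j < ?Y \<omega> \<and> real k < ?Z \<omega>} = (\<Prod>i=1..n. (1 - p i) ^ ?t j k i)" for j k
  proof -
    have ne: "{1..n} \<noteq> {}" using assms by auto
    have "{\<omega> \<in> space M. real j < ?Y \<omega> \<and> real k < ?Z \<omega>} =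
        {\<omega> \<in> space M. \<forall>i\<in>{1..n}. real (?t j k i) < X i \<omega>}"
    proof (intro Collect_cong conj_cong refl)
      fix \<omega>
      have "real j < ?Y \<omega> \<and> real k < ?Z \<omega> \<longleftrightarrow>
          (\<forall>i\<in>{1..m}. real j < X i \<omega>) \<and> (\<forall>i\<in>{l+1..n}. real k < X i \<omega>)"
        using assms(2-4) by (subst (1 2) Min_gr_iff) auto
      also have "\<dots> \<longleftrightarrow> (\<forall>i\<in>{1..n}. (i \<le> m \<longrightarrow> real j < X i \<omega>) \<and> (l < i \<longrightarrow> real k < X i \<omega>))"
        using assms(2-4) by auto
      also have "\<dots> \<longleftrightarrow> (\<forall>i\<in>{1..n}. real (?t j k i) < X i \<omega>)"
        using assms(2-4) by (intro ball_cong refl) (auto simp: max_def)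
      finally show "real j < ?Y \<omega> \<and> real k < ?Z \<omega> \<longleftrightarrow> (\<forall>i\<in>{1..n}. real (?t j k i) < X i \<omega>)" .
    qed
    also have "\<dots> = (\<Inter>i\<in>{1..n}. X i -` {real (?t j k i)<..} \<inter> space M)"
      using ne by auto
    also have "prob \<dots> = (\<Prod>i=1..n. prob (X i -` {real (?t j k i)<..} \<inter> space M))"
      by (rule indep_varsD[OF assms(7) ne]) auto
    also have "\<dots> = (\<Prod>i=1..n. (1 - p i) ^ ?t j k i)"
    proof (rule prod.cong[OF refl])
      fix i assume i: "i \<in> {1..n}"
      have "X i -` {real (?t j k i)<..} \<inter> space M = {\<omega> \<in> space M. real (?t j k i) < X i \<omega>}" by auto
      then show "prob (X i -` {real (?t j k i)<..} \<inter> space M) = (1 - p i) ^ ?t j k i"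
        using geometric_rv_survival[OF assms(6)[OF i]] by simp
    qed
    finally show ?thesis .
  qed
  have main: "maximal_correlation ?Y ?Z = (?\<gamma> - ?\<alpha> * ?\<beta>) / sqrt (?\<alpha> * (1 - ?\<alpha>) * ?\<beta> * (1 - ?\<beta>))"
  proof (rule maximal_correlation_memoryless)
    show "random_variable borel ?Y" "random_variable borel ?Z"
      using assms(2-4) by (auto intro!: borel_measurable_Min X)
    show "AE \<omega> in M. \<exists>k::nat. 1 \<le> k \<and> ?Y \<omega> = real k"
      using assms(2-4) by (intro AE_Min_nat X_nat) auto
    show "AE \<omega> in M. \<exists>k::nat. 1 \<le> k \<and> ?Z \<omega> = real k"
      using assms(2-4) by (intro AE_Min_nat X_nat) auto
    show "prob {\<omega> \<in> space M. real (Suc j) < ?Y \<omega> \<and> real (Suc k) < ?Z \<omega>} =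
        ?\<gamma> * prob {\<omega> \<in> space M. real j < ?Y \<omega> \<and> real k < ?Z \<omega>}" for j k
      unfolding surv prod.distrib[symmetric]
    proof (rule prod.cong[OF refl])
      fix i
      \<comment> \<open>As \<open>l < m\<close>, every index lies in at least one block, so raising
        both levels by one raises every threshold by exactly one.\<close>
      have "?t (Suc j) (Suc k) i = Suc (?t j k i)" using assms(3) by auto
      then show "(1 - p i) ^ ?t (Suc j) (Suc k) i = (1 - p i) * (1 - p i) ^ ?t j k i" by simp
    qed
    show "prob {\<omega> \<in> space M. real j < ?Y \<omega> \<and> 0 < ?Z \<omega>} = ?\<alpha> ^ j" for j
    proof -
      \<comment> \<open>Indices beyond \<open>m\<close> have threshold 0 and contribute the factor
        1.\<close>
      have "(\<Prod>i=1..n. (1 - p i) ^ ?t j 0 i) = (\<Prod>i=1..m. (1 - p i) ^ j)"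
        using assms(4) by (intro prod.mono_neutral_cong_right) auto
      then show ?thesis using surv[of j 0] by (simp add: prod_power_distrib)
    qed
    show "prob {\<omega> \<in> space M. 0 < ?Y \<omega> \<and> real k < ?Z \<omega>} = ?\<beta> ^ k" for k
    proof -
      have "(\<Prod>i=1..n. (1 - p i) ^ ?t 0 k i) = (\<Prod>i=l+1..n. (1 - p i) ^ k)"
        by (intro prod.mono_neutral_cong_right) auto
      then show ?thesis using surv[of 0 k] by (simp add: prod_power_distrib)
    qed
    show "0 < ?\<alpha>" "0 < ?\<beta>" using p assms(4) by (auto intro!: prod_pos)
    show "?\<alpha> < 1" "?\<beta> < 1" using p assms(2-4) by (intro prod_less_1_real; auto)+
    show "?\<alpha> * ?\<beta> \<le> ?\<gamma>"
    proof -
      \<comment> \<open>The indices common to both blocks occur twice in \<alpha>\<beta> but once in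
        \<gamma>; their extra factor is at most 1.\<close>
      have "?\<beta> = (\<Prod>i\<in>{l+1..m} \<union> {m+1..n}. 1 - p i)"
        using assms(3,4) by (intro prod.cong) auto
      also have "\<dots> = (\<Prod>i=l+1..m. 1 - p i) * (\<Prod>i=m+1..n. 1 - p i)"
        by (rule prod.union_disjoint) auto
      also have "\<dots> \<le> 1 * (\<Prod>i=m+1..n. 1 - p i)"
        using p assms(4)
        by (intro mult_right_mono prod_le_1 prod_nonneg) (auto intro: less_imp_le)
      finally have "?\<alpha> * ?\<beta> \<le> ?\<alpha> * (\<Prod>i=m+1..n. 1 - p i)"
        using p assms(4) by (intro mult_left_mono prod_nonneg) (auto intro: less_imp_le)
      also have "\<dots> = (\<Prod>i\<in>{1..m} \<union> {m+1..n}. 1 - p i)"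
        by (rule prod.union_disjoint[symmetric]) auto
      also have "{1..m} \<union> {m+1..n} = {1..n}" using assms(4) by auto
      finally show ?thesis .
    qed
  qed
  have "maximal_correlation (\<lambda>\<omega>. min (X 1 \<omega>) (X 2 \<omega>)) (\<lambda>\<omega>. min (X 2 \<omega>) (X 3 \<omega>)) =
      sqrt ((1 - p 1) * (1 - p 3)) * p 2 /
      sqrt ((1 - (1 - p 1) * (1 - p 2)) * (1 - (1 - p 2) * (1 - p 3)))"
    if nml: "n = 3" "m = 2" "l = 1"
  proof -
    have s: "{1..2::nat} = {1, 2}" "{1..3::nat} = {1, 2, 3}" "{1+1..3::nat} = {2, 3}" by auto
    \<comment> \<open>Numerator and denominator share the factor \<open>b * sqrt (a * c)\<close>;
      cancelling it leaves \<open>1 - b\<close>, which is \<open>p 2\<close>.\<close>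
    define a b c where "a = 1 - p 1" and "b = 1 - p 2" and "c = 1 - p 3"
    have pos: "0 < a" "0 < b" "0 < c" using p nml by (auto simp: a_def b_def c_def)
    have "a * b * (1 - a * b) * (b * c) * (1 - b * c) = b\<^sup>2 * (a * c) * ((1 - a * b) * (1 - b * c))"
      by (simp add: power2_eq_square algebra_simps)
    then have "sqrt (a * b * (1 - a * b) * (b * c) * (1 - b * c)) =
        b * sqrt (a * c) * sqrt ((1 - a * b) * (1 - b * c))"
      using pos by (simp add: real_sqrt_mult)
    moreover have "a * (b * c) - a * b * (b * c) = b * sqrt (a * c) * (sqrt (a * c) * (1 - b))"
    proof -
      have "sqrt (a * c) * sqrt (a * c) = a * c" using pos by simp
      then have "b * sqrt (a * c) * (sqrt (a * c) * (1 - b)) = b * (1 - b) * (a * c)"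
        by (metis (no_types, opaque_lifting) mult.assoc mult.commute)
      then show ?thesis by (simp add: algebra_simps)
    qed
    moreover have "b * sqrt (a * c) \<noteq> 0" using pos by simp
    ultimately have "(a * (b * c) - a * b * (b * c)) / sqrt (a * b * (1 - a * b) * (b * c) * (1 - b * c)) =
        sqrt (a * c) * (1 - b) / sqrt ((1 - a * b) * (1 - b * c))"
      by (metis mult.assoc mult_divide_mult_cancel_left)
    then show ?thesis
      using main unfolding nml s by (simp add: a_def b_def c_def)
  qed
  with main show ?thesis by blast
qed

end
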